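(* Let $(G,\cdot)$ be a commutative group and let $f,\alpha\colon G\to\mathbb{C}$ be functions for which \[ f(x\cdot y)=f(x)f(y)+\alpha(x)\alpha(y)\qquad\text{for all } x,y\in G. \] Then there exist an additive function $a\colon G\to\mathbb{C}$ and exponential functions $m,m_{1},m_{2}\colon G\to\mathbb{C}$ such that the system $\{m_{1},m_{2}\}$ is linearly independent, and further there are complex constants $\alpha_{1},\alpha_{2},\gamma_{1},\gamma_{2}$ and $\gamma\neq 0$, such that the pair $(f,\alpha)$ has one of the following forms. (i) $f(x)=(\gamma_{1}a(x)+\gamma_{2})\cdot m(x)$ and $\alpha(x)=(\alpha_{1}a(x)+\alpha_{2})\cdot m(x)$ for all $x\in G$, where the constants satisfy \[ \gamma_{1}^{2}+\alpha_{1}^{2}=0,\qquad \gamma_{2}^{2}+\alpha_{2}^{2}=\gamma_{2},\qquad \gamma_{1}\gamma_{2}+\alpha_{1}\alpha_{2}=\gamma_{1}. \] (ii) $f(x)=\gamma_{1}\cdot m_{1}(x)+\gamma_{2}\cdot m_{2}(x)$ and $\alpha(x)=\alpha_{1}\cdot m_{1}(x)+\alpha_{2}\cdot m_{2}(x)$ for all $x\in G$, where the constants satisfy \[ \gamma_{1}^{2}+\alpha_{1}^{2}=\gamma_{1},\qquad \gamma_{2}^{2}+\alpha_{2}^{2}=\gamma_{2},\qquad \gamma_{1}\gamma_{2}+\alpha_{1}\alpha_{2}=0. \] (iii) Either $f$ and $\alpha$ are identically zero, or $f(x)=\gamma\cdot m(x)$ and $\alpha(x)=\pm\sqrt{\gamma(1-\gamma)}\cdot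 m(x)$ for all $x\in G$ (with one fixed choice of the sign).
   Context: A function $a\colon G\to\mathbb{C}$ is additive if $a(x\cdot y)=a(x)+a(y)$ for all $x,y\in G$. A function $m\colon G\to\mathbb{C}$ is exponential if $m(x\cdot y)=m(x)m(y)$ for all $x,y\in G$ (the identically zero function is allowed). Here $\pm\sqrt{z}$ for $z\in\mathbb{C}$ denotes the complex square roots of $z$.
   Formalization: For the one-element group no linearly independent system {m1, m2} exists, so there its independence is required only inside form (ii); for every other group it is required throughout, as stated. *)

theory Defs
  imports Complex_Main "HOL-Algebra.Group"
begin

definition additive_fun :: "('a, 'b) monoid_scheme \<Rightarrow> ('a \<Rightarrow> complex) \<Rightarrow> bool" where
  "additive_fun G a \<longleftrightarrow>
     (\<forall>x\<in>carrier G. \<forall>y\<in>carrier G. a (x \<otimes>\<^bsub>G\<^esub> y) = a x + a y)"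

(* The zero function is allowed. *)
definition exponential_fun :: "('a, 'b) monoid_scheme \<Rightarrow> ('a \<Rightarrow> complex) \<Rightarrow> bool" where
  "exponential_fun G m \<longleftrightarrow>
     (\<forall>x\<in>carrier G. \<forall>y\<in>carrier G. m (x \<otimes>\<^bsub>G\<^esub> y) = m x * m y)"

(* Linear independence over the complex numbers of the two-element system (m1, m2) of
   functions on carrier G. It is that of an indexed family, so it implies that m1 and m2
   differ on carrier G; independence of the set {m1, m2} would not exclude m1 = m2. *)
definition lin_indep_pair ::
  "('a, 'b) monoid_scheme \<Rightarrow> ('a \<Rightarrow> complex) \<Rightarrow> ('a \<Rightarrow> complex) \<Rightarrow> bool" where
  "lin_indep_pair G m1 m2 \<longleftrightarrow>
     (\<forall>c1 c2 :: complex.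
        (\<forall>x\<in>carrier G. c1 * m1 x + c2 * m2 x = 0) \<longrightarrow> c1 = 0 \<and> c2 = 0)"

end

theory Submission
  imports Defs
begin

text \<open>
  If \<open>\<alpha>\<close> does not vanish, associativity and commutativity yield a constant \<open>c\<close> with
  \<open>\<alpha> (x y) = f x \<alpha> y + \<alpha> x f y + 2 c \<alpha> x \<alpha> y\<close>. Hence \<open>f + k \<alpha>\<close> is exponential
  for each root \<open>k\<close> of \<open>k\<^sup>2 = 1 + 2 c k\<close>. Two distinct roots express \<open>f\<close> and \<open>\<alpha>\<close> through two
  exponentials; for a double root, \<open>\<alpha> / (f + k \<alpha>)\<close> is additive.

  The linearly independent pair is demanded also when the exponentials coming from \<open>f\<close> and \<open>\<alpha>\<close> do
  not provide one. It exists on every nontrivial abelian group because characters with values in the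
  divisible group \<open>\<complex>\<^sup>*\<close> extend from subgroups, by Zorn's lemma.
\<close>

subsection \<open>Characters of abelian groups\<close>

text \<open>The graph of a homomorphism from a subgroup to the multiplicative group of \<open>\<complex>\<close>.\<close>

definition character_graph :: "('a, 'b) monoid_scheme \<Rightarrow> ('a \<times> complex) set \<Rightarrow> bool" where
  "character_graph G K \<longleftrightarrow>
     K \<subseteq> carrier G \<times> (- {0}) \<and> (\<one>\<^bsub>G\<^esub>, 1) \<in> K \<and>
     (\<forall>g v h w. (g, v) \<in> K \<longrightarrow> (h, w) \<in> K \<longrightarrow> (g \<otimes>\<^bsub>G\<^esub> h, v * w) \<in> K) \<and>
     (\<forall>g v. (g, v) \<in> K \<longrightarrow> (inv\<^bsub>G\<^esub> g, inverse v) \<in> K) \<and>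
     (\<forall>v. (\<one>\<^bsub>G\<^esub>, v) \<in> K \<longrightarrow> v = 1)"

lemma character_graphD:
  assumes "character_graph G K"
  shows "(g, v) \<in> K \<Longrightarrow> g \<in> carrier G"
    and "(g, v) \<in> K \<Longrightarrow> v \<noteq> 0"
    and "(\<one>\<^bsub>G\<^esub>, 1) \<in> K"
    and "(g, v) \<in> K \<Longrightarrow> (h, w) \<in> K \<Longrightarrow> (g \<otimes>\<^bsub>G\<^esub> h, v * w) \<in> K"
    and "(g, v) \<in> K \<Longrightarrow> (inv\<^bsub>G\<^esub> g, inverse v) \<in> K"
    and "(\<one>\<^bsub>G\<^esub>, v) \<in> K \<Longrightarrow> v = 1"
  using assms by (auto simp: character_graph_def)

context comm_group
begin

text \<open>Dividing two pairs over the same point gives a pair over \<open>\<one>\<close>, where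
  the only value is 1. So the clause at \<open>\<one>\<close> alone makes the graph
  single-valued.\<close>

lemma character_graph_unique:
  assumes K: "character_graph G K" and "(g, v) \<in> K" "(g, w) \<in> K"
  shows "v = w"
proof -
  have "(g \<otimes> inv g, v * inverse w) \<in> K"
    using assms character_graphD(4,5)[OF K] by blast
  moreover have "g \<otimes> inv g = \<one>"
    using character_graphD(1)[OF K assms(2)] by simp
  ultimately have "v * inverse w = 1"
    using character_graphD(6)[OF K] by simp
  with character_graphD(2)[OF K assms(3)] show ?thesis
    by (simp add: field_simps)
qed

lemma character_graph_nat_pow:
  assumes K: "character_graph G K" and "(g, v) \<in> K"
  shows "(g [^] (n::nat), v ^ n) \<in> K"
proof (induction n)
  case 0
  show ?case using character_graphD(3)[OF K] by simp
next
  case (Suc n)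
  from character_graphD(4)[OF K Suc assms(2)] show ?case by (simp add: mult.commute)
qed

lemma character_graph_int_pow:
  assumes K: "character_graph G K" and gv: "(g, v) \<in> K"
  shows "(g [^] (n::int), v powi n) \<in> K"
proof (cases "n \<ge> 0")
  case True
  then show ?thesis
    using character_graph_nat_pow[OF K gv, of "nat n"]
    by (simp add: power_int_def int_pow_def nat_pow_def)
next
  case False
  then show ?thesis
    using character_graphD(5)[OF K character_graph_nat_pow[OF K gv, of "nat (- n)"]]
    by (simp add: power_int_def int_pow_def nat_pow_def power_inverse)
qed

text \<open>Supplies a value for a new element \<open>g\<close> that agrees with \<open>K\<close> on
  every power of \<open>g\<close> already in its domain. The value is kept away from 1 so that the
  extended character separates \<open>g\<close> from \<open>\<one>\<close>.\<close>

lemma character_graph_powers_value: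
  assumes K: "character_graph G K" and g: "g \<in> carrier G" "g \<notin> Domain K"
  obtains w where "w \<noteq> 0" "w \<noteq> 1" "\<And>(n::int) v. (g [^] n, v) \<in> K \<Longrightarrow> v = w powi n"
proof (cases "\<exists>d::nat. d > 0 \<and> g [^] d \<in> Domain K")
  case False
  have zero: "n = 0" if "(g [^] n, v) \<in> K" for n :: int and v
  proof (rule ccontr)
    assume "n \<noteq> 0"
    have "(g [^] nat \<bar>n\<bar>) \<in> Domain K"
    proof (cases "n > 0")
      case True
      with that show ?thesis by (auto simp: int_pow_def nat_pow_def)
    next
      case False
      have "(g [^] (- n), inverse v) \<in> K"
        using character_graphD(5)[OF K that] g(1) by (simp add: int_pow_neg)
      with False \<open>n \<noteq> 0\<close> show ?thesis by (auto simp: int_pow_def nat_pow_def)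
    qed
    moreover have "nat \<bar>n\<bar> > 0"
      using \<open>n \<noteq> 0\<close> by simp
    ultimately show False
      using False by blast
  qed
  show ?thesis
  \<comment> \<open>Only the exponent 0 puts a power of \<open>g\<close> into the domain, so the
    value of \<open>g\<close> is free apart from avoiding 0 and 1.\<close>
  proof (rule that[of 2])
    fix n :: int and v
    assume nv: "(g [^] n, v) \<in> K"
    from zero[OF nv] nv character_graphD(6)[OF K, of v] show "v = 2 powi n" by simp
  qed auto
next
  case True
  define d where "d = (LEAST d::nat. d > 0 \<and> g [^] d \<in> Domain K)"
  have d: "d > 0" "g [^] d \<in> Domain K"
    using LeastI_ex[OF True] by (auto simp: d_def)
  have least: "d \<le> e" if "e > 0" "g [^] e \<in> Domain K" for e :: nat
    using that by (auto simp: d_def intro: Least_le)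
  obtain z where z: "(g [^] d, z) \<in> K"
    using d by auto
  have "d \<noteq> 1"
    using d g by auto
  \<comment> \<open>Since \<open>d\<close> is at least 2, the nonzero number \<open>z\<close> has
    several \<open>d\<close>-th roots, and one of them differs from 1.\<close>
  have "card {w. w ^ d = z} = d"
    using card_nth_roots[of z d] character_graphD(2)[OF K z] d by simp
  have "\<not> {w. w ^ d = z} \<subseteq> {1}"
  proof
    assume "{w. w ^ d = z} \<subseteq> {1}"
    from card_mono[OF _ this] have "card {w. w ^ d = z} \<le> 1"
      by simp
    with \<open>card {w. w ^ d = z} = d\<close> d \<open>d \<noteq> 1\<close> show False
      by simp
  qed
  then obtain w where w: "w ^ d = z" "w \<noteq> 1"
    by auto
  have "w \<noteq> 0"
    using w(1) d character_graphD(2)[OF K z] by (auto simp: power_0_left)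
  have z': "(g [^] (int d * k), w powi (int d * k)) \<in> K" for k
  proof -
    have "(g [^] d) [^] k = g [^] (int d * k)"
      using g by (simp add: int_pow_pow flip: int_pow_int)
    moreover have "z powi k = w powi (int d * k)"
      by (simp add: power_int_mult flip: w(1))
    ultimately show ?thesis
      using character_graph_int_pow[OF K z, of k] by simp
  qed
  show ?thesis
  proof (rule that[OF \<open>w \<noteq> 0\<close> \<open>w \<noteq> 1\<close>])
    fix n :: int and v
    assume n: "(g [^] n, v) \<in> K"
    \<comment> \<open>Division with remainder: removing a multiple of \<open>d\<close> from the
      exponent leaves a power below \<open>d\<close> in the domain, so minimality of
      \<open>d\<close> forces remainder 0.\<close>
    have "(g [^] n \<otimes> g [^] (int d * - (n div int d)), v * w powi (int d * - (n div int d))) \<in> K"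
      using character_graphD(4)[OF K n z'] .
    moreover have "n + int d * - (n div int d) = n mod int d"
      by (simp add: minus_mult_div_eq_mod)
    ultimately have "g [^] (n mod int d) \<in> Domain K"
      using g by (auto simp flip: int_pow_mult)
    moreover have "g [^] (n mod int d) = g [^] nat (n mod int d)"
      using d by (simp flip: int_pow_int)
    ultimately have "\<not> nat (n mod int d) > 0"
      using least[of "nat (n mod int d)"] d
      by (metis nat_int nat_less_eq_zless not_le of_nat_0_less_iff pos_mod_bound pos_mod_sign)
    then have "n mod int d = 0"
      using d by (simp add: order_antisym)
    then have "n = int d * (n div int d)"
      by auto
    then show "v = w powi n"
      using character_graph_unique[OF K n] z'[of "n div int d"] by simp
  qed
qed

text \<open>The subgroup generated by the domain and \<open>g\<close> consists of the products of
  some \<open>h\<close> in the domain with a power of \<open>g\<close>, and the extension sends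
  \<open>g\<close> to \<open>w\<close>. Such products need not be unique; the choice of
  \<open>w\<close> makes the value independent of the representation.\<close>

lemma character_graph_extend:
  assumes K: "character_graph G K" and g: "g \<in> carrier G" "g \<notin> Domain K"
  obtains L w where "character_graph G L" "K \<subseteq> L" "(g, w) \<in> L" "w \<noteq> 1"
proof -
  obtain w where w: "w \<noteq> 0" "w \<noteq> 1"
      and pow: "\<And>(n::int) v. (g [^] n, v) \<in> K \<Longrightarrow> v = w powi n"
    using character_graph_powers_value[OF assms] by blast
  define L where "L = {(h \<otimes> g [^] n, v * w powi n) | h v (n::int). (h, v) \<in> K}"
  have LI: "(h \<otimes> g [^] n, v * w powi n) \<in> L" if "(h, v) \<in> K" for h v and n :: int
    using that by (auto simp: L_def)
  have "K \<subseteq> L"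
  proof clarify
    fix h v assume hv: "(h, v) \<in> K"
    from LI[OF this, of 0] character_graphD(1)[OF K hv] show "(h, v) \<in> L" by simp
  qed
  moreover have "(g, w) \<in> L"
    using LI[OF character_graphD(3)[OF K], of 1] g by simp
  moreover have "character_graph G L"
    unfolding character_graph_def
  proof (intro conjI allI impI)
    show "L \<subseteq> carrier G \<times> - {0}"
      using character_graphD(1,2)[OF K] g w by (auto simp: L_def)
    show "(\<one>, 1) \<in> L"
      using \<open>K \<subseteq> L\<close> character_graphD(3)[OF K] by auto
  next
    fix x s y t assume "(x, s) \<in> L" "(y, t) \<in> L"
    then obtain h u n k v l where
      1: "(h, u) \<in> K" "x = h \<otimes> g [^] (n::int)" "s = u * w powi n" and
      2: "(k, v) \<in> K" "y = k \<otimes> g [^] (l::int)" "t = v * w powi l"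
      by (auto simp: L_def)
    have "x \<otimes> y = (h \<otimes> k) \<otimes> g [^] (n + l)"
      using 1 2 g character_graphD(1)[OF K] by (simp add: int_pow_mult m_ac)
    moreover have "s * t = (u * v) * w powi (n + l)"
      using 1 2 w by (simp add: power_int_add)
    ultimately show "(x \<otimes> y, s * t) \<in> L"
      using LI[OF character_graphD(4)[OF K 1(1) 2(1)]] by simp
  next
    fix x s assume "(x, s) \<in> L"
    then obtain h u n where 1: "(h, u) \<in> K" "x = h \<otimes> g [^] (n::int)" "s = u * w powi n"
      by (auto simp: L_def)
    have "inv x = inv h \<otimes> g [^] (- n)"
      using 1 g character_graphD(1)[OF K] by (simp add: int_pow_neg inv_mult)
    moreover have "inverse s = inverse u * w powi (- n)"
      using 1 by (simp add: power_int_minus)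
    ultimately show "(inv x, inverse s) \<in> L"
      using LI[OF character_graphD(5)[OF K 1(1)]] by simp
  next
    fix s assume "(\<one>, s) \<in> L"
    then obtain h u n where 1: "(h, u) \<in> K" "\<one> = h \<otimes> g [^] (n::int)" "s = u * w powi n"
      by (auto simp: L_def)
    have h: "h \<in> carrier G"
      using character_graphD(1)[OF K 1(1)] .
    \<comment> \<open>Here a power of \<open>g\<close> falls into the old domain, where its value is
      prescribed to be the matching power of \<open>w\<close>.\<close>
    have "inv h = g [^] n"
      using 1(2) h g by (metis int_pow_closed inv_equality m_comm)
    then have "inverse u = w powi n"
      using pow character_graphD(5)[OF K 1(1)] by simp
    then show "s = 1"
      using 1 character_graphD(2)[OF K 1(1)] by (simp flip: \<open>inverse u = w powi n\<close>)
  qed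
  ultimately show ?thesis
    using that w(2) by blast
qed

text \<open>Every clause of \<open>character_graph\<close> involves at most two given pairs, and in
  a chain two pairs lie in a common member.\<close>

lemma character_graph_Union:
  assumes "subset.chain (Collect (character_graph G)) C" "C \<noteq> {}"
  shows "character_graph G (\<Union>C)"
proof -
  have K: "character_graph G K" if "K \<in> C" for K
    using assms that by (auto simp: subset_chain_def)
  have common: "\<exists>K\<in>C. p \<in> K \<and> q \<in> K" if "p \<in> \<Union>C" "q \<in> \<Union>C" for p q
    using assms that unfolding subset_chain_def by blast
  show ?thesis
    unfolding character_graph_def
  proof (intro conjI allI impI)
    show "\<Union>C \<subseteq> carrier G \<times> - {0}"
      using K character_graphD(1,2) by fastforce
    show "(\<one>, 1) \<in> \<Union>C"
      using K character_graphD(3) assms(2) by blast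
  next
    fix x s y t assume "(x, s) \<in> \<Union>C" "(y, t) \<in> \<Union>C"
    then obtain L where L: "L \<in> C" "(x, s) \<in> L" "(y, t) \<in> L"
      using common by meson
    from character_graphD(4)[OF K[OF L(1)] L(2,3)] L(1) show "(x \<otimes> y, s * t) \<in> \<Union>C"
      by blast
  next
    fix x s assume "(x, s) \<in> \<Union>C"
    then obtain L where L: "L \<in> C" "(x, s) \<in> L"
      by blast
    from character_graphD(5)[OF K[OF L(1)] L(2)] L(1) show "(inv x, inverse s) \<in> \<Union>C"
      by blast
  next
    fix s assume "(\<one>, s) \<in> \<Union>C"
    then obtain L where L: "L \<in> C" "(\<one>, s) \<in> L"
      by blast
    from character_graphD(6)[OF K[OF L(1)] L(2)] show "s = 1" .
  qed
qed

lemma exists_nontrivial_character: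
  assumes g: "g \<in> carrier G" "g \<noteq> \<one>"
  obtains m where "exponential_fun G m" "m \<one> = 1" "m g \<noteq> 1"
proof -
  have "character_graph G {(\<one>, 1)}" "g \<notin> Domain {(\<one>, 1 :: complex)}"
    using g by (auto simp: character_graph_def)
  then obtain K0 w where K0: "character_graph G K0" "{(\<one>, 1)} \<subseteq> K0" "(g, w) \<in> K0" "w \<noteq> 1"
    using character_graph_extend g(1) by metis
  \<comment> \<open>Zorn's lemma is applied only to graphs through \<open>(g, w)\<close>, so the
    maximal one keeps a value other than 1 at \<open>g\<close>.\<close>
  define A where "A = {K. character_graph G K \<and> (g, w) \<in> K}"
  have "\<exists>M\<in>A. \<forall>X\<in>A. M \<subseteq> X \<longrightarrow> X = M"
  proof (rule subset_Zorn_nonempty)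
    show "A \<noteq> {}"
      using K0 by (auto simp: A_def)
    fix C assume C: "C \<noteq> {}" "subset.chain A C"
    then have "subset.chain (Collect (character_graph G)) C"
      by (auto simp: A_def subset_chain_def)
    from character_graph_Union[OF this C(1)] C show "\<Union>C \<in> A"
      by (auto simp: A_def subset_chain_def)
  qed
  then obtain M where M: "character_graph G M" "(g, w) \<in> M"
      and max: "\<And>X. character_graph G X \<Longrightarrow> M \<subseteq> X \<Longrightarrow> X = M"
    by (auto simp: A_def)
  \<comment> \<open>A point outside the domain of \<open>M\<close> would allow a proper extension,
    against maximality.\<close>
  have total: "\<exists>v. (h, v) \<in> M" if "h \<in> carrier G" for h
  proof (rule ccontr)
    assume "\<nexists>v. (h, v) \<in> M"
    then have "h \<notin> Domain M" by auto
    from character_graph_extend[OF M(1) that this] max \<open>h \<notin> Domain M\<close> show False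
      by (metis DomainI)
  qed
  define m where "m h = (THE v. (h, v) \<in> M)" for h
  have m_eq: "m h = v" if "(h, v) \<in> M" for h v
    using that character_graph_unique[OF M(1)] by (auto simp: m_def)
  have "exponential_fun G m"
    unfolding exponential_fun_def
  proof (intro ballI)
    fix x y assume "x \<in> carrier G" "y \<in> carrier G"
    then obtain s t where "(x, s) \<in> M" "(y, t) \<in> M"
      using total by blast
    then show "m (x \<otimes> y) = m x * m y"
      using character_graphD(4)[OF M(1)] m_eq by metis
  qed
  moreover have "m \<one> = 1"
    using m_eq character_graphD(3)[OF M(1)] .
  moreover have "m g \<noteq> 1"
    using m_eq[OF M(2)] K0 by simp
  ultimately show ?thesis
    using that by blast
qed

subsection \<open>Exponential functions\<close>

text \<open>In a group every element is a multiple of a given zero \<open>z\<close>, so one zero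
  spreads everywhere. Without zeros, the value at \<open>\<one>\<close> is a nonzero
  idempotent.\<close>

lemma exponential_fun_zero_or_one:
  assumes "exponential_fun G m"
  obtains "\<forall>x\<in>carrier G. m x = 0" | "m \<one> = 1" "\<forall>x\<in>carrier G. m x \<noteq> 0"
proof (cases "\<exists>x\<in>carrier G. m x = 0")
  case True
  then obtain z where z: "z \<in> carrier G" "m z = 0" by blast
  have "m x = 0" if "x \<in> carrier G" for x
  proof -
    have "m x = m (z \<otimes> (inv z \<otimes> x))"
      using z that by (simp flip: m_assoc)
    also have "\<dots> = m z * m (inv z \<otimes> x)"
      using assms z that by (simp add: exponential_fun_def)
    finally show ?thesis using z by simp
  qed
  then show ?thesis using that(1) by blast
next
  case False
  have "m \<one> = m \<one> * m \<one>"
    using assms unfolding exponential_fun_def by (metis one_closed r_one)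
  with False have "m \<one> = 1" by auto
  with False that(2) show ?thesis by blast
qed

text \<open>A linear relation evaluated at \<open>\<one>\<close> gives \<open>c1 + c2 = 0\<close>;
  evaluated at a point where the functions differ, it then gives \<open>c1 = 0\<close>.\<close>

lemma lin_indep_pairI:
  assumes m1: "exponential_fun G m1" "\<exists>x\<in>carrier G. m1 x \<noteq> 0"
    and m2: "exponential_fun G m2" "\<exists>x\<in>carrier G. m2 x \<noteq> 0"
    and neq: "\<exists>x\<in>carrier G. m1 x \<noteq> m2 x"
  shows "lin_indep_pair G m1 m2"
  unfolding lin_indep_pair_def
proof (intro allI impI)
  fix c1 c2 assume c: "\<forall>x\<in>carrier G. c1 * m1 x + c2 * m2 x = 0"
  have "m1 \<one> = 1" "m2 \<one> = 1"
    using exponential_fun_zero_or_one m1 m2 by metis+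
  with c have "c1 + c2 = 0"
    by (metis mult.right_neutral one_closed)
  then have c2: "c2 = - c1"
    by (metis add_eq_0_iff)
  obtain x where x: "x \<in> carrier G" "m1 x \<noteq> m2 x"
    using neq by blast
  have "c1 * (m1 x - m2 x) = 0"
    using bspec[OF c x(1)] unfolding c2 by (simp add: algebra_simps)
  with x c2 show "c1 = 0 \<and> c2 = 0" by simp
qed

text \<open>A nontrivial character is paired with the constant 1. On a one-element group the
  functions form a one-dimensional space, which rules out an independent pair; hence the
  guard.\<close>

lemma exists_lin_indep_exponentials:
  obtains m1 m2 where "exponential_fun G m1" "exponential_fun G m2"
    "carrier G \<noteq> {\<one>} \<longrightarrow> lin_indep_pair G m1 m2"
proof (cases "carrier G = {\<one>}")
  case True
  then show ?thesis
    using that[of "\<lambda>_. 1" "\<lambda>_. 1"] by (simp add: exponential_fun_def)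
next
  case False
  then obtain g where g: "g \<in> carrier G" "g \<noteq> \<one>"
    using one_closed by blast
  obtain m where m: "exponential_fun G m" "m \<one> = 1" "m g \<noteq> 1"
    using exists_nontrivial_character[OF g] .
  have one: "exponential_fun G (\<lambda>_. 1)"
    by (simp add: exponential_fun_def)
  have "lin_indep_pair G m (\<lambda>_. 1)"
  proof (intro lin_indep_pairI m one)
    show "\<exists>x\<in>carrier G. m x \<noteq> 0"
      using m(2) by (intro bexI[of _ \<one>]) auto
    show "\<exists>x\<in>carrier G. (1 :: complex) \<noteq> 0" "\<exists>x\<in>carrier G. m x \<noteq> 1"
      using g m(3) by auto
  qed
  with m one show ?thesis
    using that by blast
qed

subsection \<open>The functional equation\<close>

lemma companion_addition_formula:
  assumes eq: "\<And>x y. x \<in> carrier G \<Longrightarrow> y \<in> carrier G \<Longrightarrow> f (x \<otimes> y) = f x * f y + \<alpha> x * \<alpha> y"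
    and z: "z \<in> carrier G" "\<alpha> z \<noteq> (0 :: complex)"
  obtains c where "\<And>x y. x \<in> carrier G \<Longrightarrow> y \<in> carrier G \<Longrightarrow>
    \<alpha> (x \<otimes> y) = f x * \<alpha> y + \<alpha> x * f y + 2 * c * \<alpha> x * \<alpha> y"
proof -
  define h where "h y = (\<alpha> (y \<otimes> z) - \<alpha> y * f z) / \<alpha> z" for y
  have h: "\<alpha> (x \<otimes> y) = f x * \<alpha> y + \<alpha> x * h y" if xy: "x \<in> carrier G" "y \<in> carrier G" for x y
  proof -
    \<comment> \<open>Expanding both bracketings by the equation, the terms
      \<open>f x * f y * f z\<close> cancel, and division by \<open>\<alpha> z\<close> isolates
      \<open>\<alpha> (x \<otimes> y)\<close>.\<close>
    have "f (x \<otimes> y \<otimes> z) = f (x \<otimes> (y \<otimes> z))"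
      using xy z by (simp add: m_assoc)
    then have "\<alpha> (x \<otimes> y) * \<alpha> z = f x * \<alpha> y * \<alpha> z + \<alpha> x * (\<alpha> (y \<otimes> z) - \<alpha> y * f z)"
      using xy z by (simp add: eq algebra_simps)
    then show ?thesis
      using z(2) by (simp add: h_def field_simps)
  qed
  \<comment> \<open>Comparing \<open>\<alpha> (x \<otimes> z)\<close> with
    \<open>\<alpha> (z \<otimes> x)\<close> shows that \<open>h - f\<close> is a constant multiple
    of \<open>\<alpha>\<close>. Writing the constant as \<open>2 * c\<close> simplifies the later
    quadratic.\<close>
  define c where "c = (h z - f z) / (2 * \<alpha> z)"
  have c: "h x = f x + 2 * c * \<alpha> x" if x: "x \<in> carrier G" for x
  proof -
    have "f x * \<alpha> z + \<alpha> x * h z = f z * \<alpha> x + \<alpha> z * h x"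
      using h[OF x z(1)] h[OF z(1) x] m_comm[OF x z(1)] by simp
    moreover have "2 * c * \<alpha> z = h z - f z"
      using z(2) by (simp add: c_def)
    ultimately have "h x * \<alpha> z = (f x + 2 * c * \<alpha> x) * \<alpha> z"
      by algebra
    then show ?thesis
      using z(2) by simp
  qed
  show ?thesis
    by (rule that[of c]) (simp add: h c algebra_simps)
qed

end

text \<open>The roots are counted with multiplicity, so \<open>k = l\<close> is possible. Vieta's
  relations decide the constants in both cases of the theorem.\<close>

lemma quadratic_roots:
  fixes c :: complex
  obtains k l where "k\<^sup>2 = 1 + 2 * c * k" "l\<^sup>2 = 1 + 2 * c * l" "k * l = - 1" "k + l = 2 * c"
proof -
  define s where "s = csqrt (c\<^sup>2 + 1)"
  have s: "s\<^sup>2 = c\<^sup>2 + 1" by (simp add: s_def)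
  show ?thesis
  proof (rule that[of "c + s" "c - s"])
    show "(c + s)\<^sup>2 = 1 + 2 * c * (c + s)" "(c - s)\<^sup>2 = 1 + 2 * c * (c - s)"
      "(c + s) * (c - s) = - 1"
      using s by algebra+
    show "c + s + (c - s) = 2 * c"
      by simp
  qed
qed

text \<open>Independence of the pair is asserted generally only for a nontrivial group, since a
  one-element group has none; form (ii) requires it in every case.\<close>

theorem theorem2:
  fixes G :: "('a, 'b) monoid_scheme" (structure)
    and f \<alpha> :: "'a \<Rightarrow> complex"
  assumes "comm_group G"
    and "\<And>x y. x \<in> carrier G \<Longrightarrow> y \<in> carrier G \<Longrightarrow> f (x \<otimes> y) = f x * f y + \<alpha> x * \<alpha> y"
  shows "\<exists>(a :: 'a \<Rightarrow> complex) (m :: 'a \<Rightarrow> complex) (m1 :: 'a \<Rightarrow> complex) (m2 :: 'a \<Rightarrow> complex)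
      (\<alpha>1 :: complex) (\<alpha>2 :: complex) (\<gamma>1 :: complex) (\<gamma>2 :: complex) (\<gamma> :: complex).
      additive_fun G a \<and> exponential_fun G m \<and> exponential_fun G m1 \<and> exponential_fun G m2 \<and>
      (carrier G \<noteq> {\<one>} \<longrightarrow> lin_indep_pair G m1 m2) \<and> \<gamma> \<noteq> 0 \<and>
      (((\<forall>x\<in>carrier G. f x = (\<gamma>1 * a x + \<gamma>2) * m x \<and> \<alpha> x = (\<alpha>1 * a x + \<alpha>2) * m x) \<and>
        \<gamma>1\<^sup>2 + \<alpha>1\<^sup>2 = 0 \<and> \<gamma>2\<^sup>2 + \<alpha>2\<^sup>2 = \<gamma>2 \<and> \<gamma>1 * \<gamma>2 + \<alpha>1 * \<alpha>2 = \<gamma>1)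
       \<or>
       (lin_indep_pair G m1 m2 \<and>
        (\<forall>x\<in>carrier G. f x = \<gamma>1 * m1 x + \<gamma>2 * m2 x \<and> \<alpha> x = \<alpha>1 * m1 x + \<alpha>2 * m2 x) \<and>
        \<gamma>1\<^sup>2 + \<alpha>1\<^sup>2 = \<gamma>1 \<and> \<gamma>2\<^sup>2 + \<alpha>2\<^sup>2 = \<gamma>2 \<and> \<gamma>1 * \<gamma>2 + \<alpha>1 * \<alpha>2 = 0)
       \<or>
       ((\<forall>x\<in>carrier G. f x = 0 \<and> \<alpha> x = 0) \<or>
        (\<forall>x\<in>carrier G. f x = \<gamma> * m x) \<and>
        ((\<forall>x\<in>carrier G. \<alpha> x = csqrt (\<gamma> * (1 - \<gamma>)) * m x) \<or>
         (\<forall>x\<in>carrier G. \<alpha> x = - csqrt (\<gamma> * (1 - \<gamma>)) * m x))))"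
proof -
  interpret comm_group G by fact
  note eq = assms(2)
  obtain n1 n2 where n: "exponential_fun G n1" "exponential_fun G n2"
      "carrier G \<noteq> {\<one>} \<longrightarrow> lin_indep_pair G n1 n2"
    \<comment> \<open>Forms (i) and (iii) yield no independent pair of their own; this one is
      supplied there.\<close>
    by (rule exists_lin_indep_exponentials)
  have zero: "additive_fun G (\<lambda>_. 0)"
    by (simp add: additive_fun_def)
  \<comment> \<open>Common exit to form (iii): \<open>sq\<close> says that \<open>\<beta>\<close> is
    a square root of \<open>\<gamma> * (1 - \<gamma>)\<close>. It covers vanishing
    \<open>\<alpha>\<close> and, later, the vanishing of one of two exponentials.\<close>
  have proportional: ?thesis
    if m: "exponential_fun G m" and "\<gamma> \<noteq> 0" and sq: "\<gamma>\<^sup>2 + \<beta>\<^sup>2 = \<gamma>"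
      and f\<alpha>: "\<forall>x\<in>carrier G. f x = \<gamma> * m x" "\<forall>x\<in>carrier G. \<alpha> x = \<beta> * m x" for m \<gamma> \<beta>
  proof -
    have "\<beta>\<^sup>2 = \<gamma> * (1 - \<gamma>)"
      using sq by (simp add: power2_eq_square right_diff_distrib eq_diff_eq add.commute)
    then have "\<beta>\<^sup>2 = (csqrt (\<gamma> * (1 - \<gamma>)))\<^sup>2"
      by simp
    then have "\<beta> = csqrt (\<gamma> * (1 - \<gamma>)) \<or> \<beta> = - csqrt (\<gamma> * (1 - \<gamma>))"
      by (simp only: power2_eq_iff)
    with f\<alpha> have "(\<forall>x\<in>carrier G. f x = 0 \<and> \<alpha> x = 0) \<or>
        (\<forall>x\<in>carrier G. f x = \<gamma> * m x) \<and>
        ((\<forall>x\<in>carrier G. \<alpha> x = csqrt (\<gamma> * (1 - \<gamma>)) * m x) \<or>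
         (\<forall>x\<in>carrier G. \<alpha> x = - csqrt (\<gamma> * (1 - \<gamma>)) * m x))"
      by metis
    with m n zero \<open>\<gamma> \<noteq> 0\<close> show ?thesis
      by - (rule exI[of _ "\<lambda>_. 0"], rule exI[of _ m], rule exI[of _ n1], rule exI[of _ n2],
          rule exI[of _ 0], rule exI[of _ 0], rule exI[of _ 0], rule exI[of _ 0],
          rule exI[of _ \<gamma>], intro conjI; (assumption | rule disjI2, rule disjI2, assumption))
  qed
  show ?thesis
  proof (cases "\<forall>x\<in>carrier G. \<alpha> x = 0")
    case True
    then have "exponential_fun G f"
      using eq by (simp add: exponential_fun_def)
    then show ?thesis
      by (rule proportional[of f 1 0]) (use True in simp_all)
  next
    case False
    then obtain z where z: "z \<in> carrier G" "\<alpha> z \<noteq> 0" by blast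
    obtain c where c: "\<And>x y. x \<in> carrier G \<Longrightarrow> y \<in> carrier G \<Longrightarrow>
        \<alpha> (x \<otimes> y) = f x * \<alpha> y + \<alpha> x * f y + 2 * c * \<alpha> x * \<alpha> y"
      using companion_addition_formula[of f \<alpha> z, OF eq z] by blast
    \<comment> \<open>In the expansion, \<open>\<alpha> x * \<alpha> y\<close> has coefficient
      \<open>1 + 2 * c * k\<close> on the left and \<open>k\<^sup>2\<close> on the right; all other
      terms agree.\<close>
    have expo: "exponential_fun G (\<lambda>x. f x + k * \<alpha> x)" if "k\<^sup>2 = 1 + 2 * c * k" for k
      unfolding exponential_fun_def
    proof (intro ballI)
      fix x y assume "x \<in> carrier G" "y \<in> carrier G"
      then have "f (x \<otimes> y) = f x * f y + \<alpha> x * \<alpha> y"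
        "\<alpha> (x \<otimes> y) = f x * \<alpha> y + \<alpha> x * f y + 2 * c * \<alpha> x * \<alpha> y"
        using eq c by blast+
      with that show "f (x \<otimes> y) + k * \<alpha> (x \<otimes> y) = (f x + k * \<alpha> x) * (f y + k * \<alpha> y)"
        by algebra
    qed
    obtain k l where k: "k\<^sup>2 = 1 + 2 * c * k" and l: "l\<^sup>2 = 1 + 2 * c * l"
        and kl: "k * l = - 1" "k + l = 2 * c"
      by (rule quadratic_roots)
    define m where "m x = f x + k * \<alpha> x" for x
    have m: "exponential_fun G m"
      unfolding m_def by (rule expo[OF k])
    show ?thesis
    proof (cases "k = l")
      case True
      \<comment> \<open>For a double root \<open>c = k\<close>, so the term with
        \<open>2 * c\<close> splits evenly between the two mixed products.\<close>
      have m\<alpha>: "\<alpha> (x \<otimes> y) = m x * \<alpha> y + \<alpha> x * m y" if "x \<in> carrier G" "y \<in> carrier G" for x y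
        using c[OF that] kl(2) True by (simp add: m_def algebra_simps)
      have nz: "m x \<noteq> 0" if "x \<in> carrier G" for x
      proof
        assume "m x = 0"
        with exponential_fun_zero_or_one[OF m] that have "\<forall>x\<in>carrier G. m x = 0" by metis
        then have "\<alpha> (z \<otimes> \<one>) = 0"
          using m\<alpha>[of z \<one>] z(1) by simp
        with z show False by simp
      qed
      \<comment> \<open>Dividing the sine-type formula \<open>m\<alpha>\<close> by
        \<open>m (x \<otimes> y) = m x * m y\<close> turns it into additivity. The constants of form
        (i) are read off from \<open>\<alpha> = a * m\<close> and
        \<open>f = m - k * \<alpha>\<close>, with \<open>k\<^sup>2 = - 1\<close>.\<close>
      define a where "a x = \<alpha> x / m x" for x
      have "additive_fun G a"
        unfolding additive_fun_def
      proof (intro ballI)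
        fix x y assume xy: "x \<in> carrier G" "y \<in> carrier G"
        with m have "m (x \<otimes> y) = m x * m y"
          by (simp add: exponential_fun_def)
        then show "a (x \<otimes> y) = a x + a y"
          using nz xy by (simp add: a_def m\<alpha> field_simps)
      qed
      moreover have "\<forall>x\<in>carrier G. f x = (- k * a x + 1) * m x \<and> \<alpha> x = (1 * a x + 0) * m x"
      proof
        fix x assume "x \<in> carrier G"
        then have "a x * m x = \<alpha> x"
          using nz by (simp add: a_def)
        then show "f x = (- k * a x + 1) * m x \<and> \<alpha> x = (1 * a x + 0) * m x"
          by (simp add: ring_distribs mult.assoc) (simp add: m_def)
      qed
      moreover have "(- k)\<^sup>2 + 1\<^sup>2 = 0" "1\<^sup>2 + 0\<^sup>2 = (1::complex)" "- k * 1 + 1 * 0 = - k"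
        using kl(1) True by (simp_all add: power2_eq_square)
      ultimately show ?thesis
        using m n
        by - (rule exI[of _ a], rule exI[of _ m], rule exI[of _ n1], rule exI[of _ n2],
            rule exI[of _ 1], rule exI[of _ 0], rule exI[of _ "- k"], rule exI[of _ 1],
            rule exI[of _ 1], intro conjI disjI1, simp_all)
    next
      case False
      define m' where "m' x = f x + l * \<alpha> x" for x
      have m': "exponential_fun G m'"
        unfolding m'_def by (rule expo[OF l])
      have d: "l - k \<noteq> 0" "k \<noteq> 0" "l \<noteq> 0"
        using False kl(1) by auto
      \<comment> \<open>These coefficients solve the linear system
        \<open>m = f + k * \<alpha>\<close>, \<open>m' = f + l * \<alpha>\<close> for
        \<open>f\<close> and \<open>\<alpha>\<close>.\<close>
      define \<beta> where "\<beta> = 1 / (l - k)"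
      define \<gamma>1 \<gamma>2 where "\<gamma>1 = l * \<beta>" and "\<gamma>2 = - k * \<beta>"
      have \<beta>: "\<beta> * (l - k) = 1"
        using d by (simp add: \<beta>_def)
      have f: "f x = \<gamma>1 * m x + \<gamma>2 * m' x" for x
        unfolding \<gamma>1_def \<gamma>2_def m_def m'_def using \<beta> by algebra
      have \<alpha>: "\<alpha> x = - \<beta> * m x + \<beta> * m' x" for x
        unfolding m_def m'_def using \<beta> by algebra
      \<comment> \<open>Replacing 1 by \<open>- k * l\<close> turns \<open>l\<^sup>2 + 1\<close>
        into \<open>l * (l - k)\<close> and \<open>k\<^sup>2 + 1\<close> into
        \<open>- k * (l - k)\<close>. The factor \<open>\<beta> * (l - k)\<close> is kept visible
        because it equals 1.\<close>
      have "\<gamma>1\<^sup>2 + (- \<beta>)\<^sup>2 = \<beta> * (l - k) * \<gamma>1" "\<gamma>2\<^sup>2 + \<beta>\<^sup>2 = \<beta> * (l - k) * \<gamma>2"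
        "\<gamma>1 * \<gamma>2 + - \<beta> * \<beta> = 0"
        unfolding \<gamma>1_def \<gamma>2_def using kl(1) by algebra+
      then have rel: "\<gamma>1\<^sup>2 + (- \<beta>)\<^sup>2 = \<gamma>1" "\<gamma>2\<^sup>2 + \<beta>\<^sup>2 = \<gamma>2" "\<gamma>1 * \<gamma>2 + - \<beta> * \<beta> = 0"
        unfolding \<beta> by simp_all
      have "\<gamma>1 \<noteq> 0" "\<gamma>2 \<noteq> 0"
        using d \<beta> by (auto simp: \<gamma>1_def \<gamma>2_def)
      \<comment> \<open>If one exponential vanishes, \<open>f\<close> and \<open>\<alpha>\<close>
        are multiples of the other, which is form (iii); otherwise form (ii) holds.\<close>
      consider "\<forall>x\<in>carrier G. m x = 0" | "\<forall>x\<in>carrier G. m' x = 0"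
        | "\<exists>x\<in>carrier G. m x \<noteq> 0" "\<exists>x\<in>carrier G. m' x \<noteq> 0" by blast
      then show ?thesis
      proof cases
        case 1
        then show ?thesis
          by (intro proportional[OF m' \<open>\<gamma>2 \<noteq> 0\<close> rel(2)]) (simp_all add: f \<alpha>)
      next
        case 2
        then show ?thesis
          by (intro proportional[OF m \<open>\<gamma>1 \<noteq> 0\<close> rel(1)]) (simp_all add: f \<alpha>)
      next
        case 3
        \<comment> \<open>\<open>\<alpha>\<close> is a multiple of \<open>m' - m\<close>, so the
          exponentials differ wherever \<open>\<alpha>\<close> is nonzero.\<close>
        have "m z \<noteq> m' z"
          using z(2) by (auto simp: \<alpha>)
        with z(1) have "lin_indep_pair G m m'"
          using lin_indep_pairI[OF m 3(1) m' 3(2)] by blast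
        moreover have "\<forall>x\<in>carrier G. f x = \<gamma>1 * m x + \<gamma>2 * m' x \<and> \<alpha> x = - \<beta> * m x + \<beta> * m' x"
          using f \<alpha> by blast
        ultimately show ?thesis
          using m m' zero rel
          by - (rule exI[of _ "\<lambda>_. 0"], rule exI[of _ m], rule exI[of _ m], rule exI[of _ m'],
              rule exI[of _ "- \<beta>"], rule exI[of _ \<beta>], rule exI[of _ \<gamma>1], rule exI[of _ \<gamma>2],
              rule exI[of _ 1], intro conjI disjI2[OF disjI1] impI, simp_all)
      qed
    qed
  qed
qed

end
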